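(* Let $A\in\mathbb{R}^{n\times n}$ be symmetric positive definite, let $M\in\mathbb{R}^{n\times n}$ be such that $M+M^T-A$ is symmetric positive definite, and let $\widetilde{M}=M(M+M^T-A)^{-1}M^T$. Let $\lambda_1\le\cdots\le\lambda_n$ and $\mathbf{v}_1,\dots,\mathbf{v}_n$ be the eigenvalues and $\widetilde{M}$-orthonormal eigenvectors of $A\mathbf{x}=\lambda\widetilde{M}\mathbf{x}$. Put $$P_\sharp=\begin{pmatrix}\mathbf{v}_1&\cdots&\mathbf{v}_{n_c}\end{pmatrix}=\begin{bmatrix}P_f\\P_c\end{bmatrix},\qquad \bar P_\sharp=P_\sharp P_c^{-1}=\begin{bmatrix}P_fP_c^{-1}\\ I\end{bmatrix},$$ where the $n_c\times n_c$ block $P_c$ of rows indexed by $C$ is assumed nonsingular, and set $$\bar R_\sharp=(\bar P_\sharp P_cP_c^T)^T\widetilde{M},\qquad S_\sharp=\begin{pmatrix}\mathbf{v}_{n_c+1}&\cdots&\mathbf{v}_n\end{pmatrix}.$$ Then: (1) $\bar R_\sharp\bar P_\sharp=I$, $\bar R_\sharp S_\sharp=0$, and $\bar P_\sharp\bar R_\sharp=\Pi_{\widetilde{M}}(P_\sharp)=\Pi_A(P_\sharp)$. (2) $$\mu^\sharp_{\widetilde{M}}:=\frac{1}{\lambda_{\min}\big((S_\sharp^T\widetilde{M}S_\sharp)^{-1}(S_\sharp^TAS_\sharp)\big)}=\frac{1}{\lambda_{n_c+1}}.$$ (3) For every $Z_\star\in\mathbb{R}^{n\times n_c}$ with $\bar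 R_\sharp Z_\star=I$, the ideal interpolation matrix associated with $\bar R_\sharp$, $S_\sharp$ and $Z_\star$, namely $P_\star=(I-S_\sharp(S_\sharp^TAS_\sharp)^{-1}S_\sharp^TA)Z_\star$, which minimizes $\mu_{\widetilde{M}}(P\bar R_\sharp)$ over all $P\in\mathbb{R}^{n\times n_c}$ with $\bar R_\sharp P=I$, coincides with the optimal one: $$P_\star=(I-S_\sharp(S_\sharp^TAS_\sharp)^{-1}S_\sharp^TA)Z_\star=\Pi_{\widetilde{M}}(\bar P_\sharp)Z_\star=\bar P_\sharp(\bar R_\sharp Z_\star)=\bar P_\sharp.$$
   Context: Here $1\le n_c<n$, and $\{1,\dots,n\}$ is split into disjoint sets $F$ and $C$ with $|C|=n_c$; unknowns are ordered with $F$ first and $C$ last. Vectors being $\widetilde{M}$-orthonormal means $\mathbf{v}_i^T\widetilde{M}\mathbf{v}_j=\delta_{ij}$. For a symmetric positive definite matrix $X$ and a full column rank matrix $P$, $\Pi_X(P)=P(P^TXP)^{-1}P^TX$ is the $X$-orthogonal projection onto $\operatorname{range}(P)$. For $R\in\mathbb{R}^{n_c\times n}$ and $P\in\mathbb{R}^{n\times n_c}$ with $RP=I$, $$\mu_X(PR)=\sup_{\mathbf{v}\ne0}\frac{\|(I-PR)\mathbf{v}\|_X^2}{\|\mathbf{v}\|_A^2},\qquad \|\mathbf{v}\|_X^2=\mathbf{v}^TX\mathbf{v}.$$ $\lambda_{\min}(\cdot)$ denotes the smallest eigenvalue. *)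

theory Defs
  imports
    Jordan_Normal_Form.Gauss_Jordan_Elimination
    Jordan_Normal_Form.Spectral_Radius
    Jordan_Normal_Form.DL_Submatrix
    "HOL-Library.Extended_Real"
begin

definition spd_mat :: "nat \<Rightarrow> real mat \<Rightarrow> bool" where
  "spd_mat n X \<longleftrightarrow> X \<in> carrier_mat n n \<and> X\<^sup>T = X \<and>
     (\<forall>v \<in> carrier_vec n. v \<noteq> 0\<^sub>v n \<longrightarrow> 0 < v \<bullet> (X *\<^sub>v v))"

(* Meaningful for nonsingular X only; otherwise mat_inverse X is None. *)
definition minv :: "real mat \<Rightarrow> real mat" where
  "minv X = the (mat_inverse X)"

definition sym_smoother :: "real mat \<Rightarrow> real mat \<Rightarrow> real mat" where
  "sym_smoother A M = M * minv (M + M\<^sup>T - A) * M\<^sup>T"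

definition orth_proj :: "real mat \<Rightarrow> real mat \<Rightarrow> real mat" where
  "orth_proj X P = P * minv (P\<^sup>T * X * P) * P\<^sup>T * X"

definition sq_norm_mat :: "real mat \<Rightarrow> real vec \<Rightarrow> real" where
  "sq_norm_mat X v = v \<bullet> (X *\<^sub>v v)"

(* mu A X Q with Q = P R is the quantity mu_X(P R). The supremum is taken in ereal so that
   it is meaningful without a boundedness proof; it is finite when A is positive definite. *)
definition mu :: "real mat \<Rightarrow> real mat \<Rightarrow> real mat \<Rightarrow> ereal" where
  "mu A X Q = (let n = dim_row A in
     SUP v \<in> carrier_vec n - {0\<^sub>v n}.
       ereal (sq_norm_mat X ((1\<^sub>m n - Q) *\<^sub>v v) / sq_norm_mat A v))"

(* spectrum X is the set of real eigenvalues of X; lambda_min is intended for matrices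
   all of whose eigenvalues are real, such as Y\<^sup>-\<^sup>1 * Z with Y positive definite and
   Z symmetric. *)
definition lambda_min :: "real mat \<Rightarrow> real" where
  "lambda_min X = Min (spectrum X)"

definition ideal_interp :: "real mat \<Rightarrow> real mat \<Rightarrow> real mat \<Rightarrow> real mat" where
  "ideal_interp A S Z = (1\<^sub>m (dim_row A) - S * minv (S\<^sup>T * A * S) * S\<^sup>T * A) * Z"

end

theory Submission
  imports Defs
begin

text \<open>
  Write \<open>V = (P\<^sub>\<sharp> S\<^sub>\<sharp>)\<close> for the matrix of all eigenvectors. Orthonormality says
  \<open>V\<^sup>T Mt V = I\<close>, so \<open>V\<^sup>T Mt\<close> is the inverse of \<open>V\<close> and \<open>V V\<^sup>T Mt = I\<close>; sorting the
  columns of \<open>V\<close> into the two blocks turns this into the splitting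
  \<open>P\<^sub>\<sharp> P\<^sub>\<sharp>\<^sup>T Mt + S\<^sub>\<sharp> S\<^sub>\<sharp>\<^sup>T Mt = I\<close> into complementary projections (lemma \<open>splitting\<close>).
  Because \<open>A V = Mt V \<Lambda>\<close> with \<open>\<Lambda>\<close> diagonal and positive, replacing \<open>Mt\<close> by \<open>A\<close> in a
  projection onto a span of eigenvectors inserts a factor \<open>\<Lambda>\<^sup>-\<^sup>1\<close> and a factor \<open>\<Lambda>\<close>, which
  cancel (lemma \<open>A_proj_eigs\<close>).

  Now \<open>Rbar\<close> simplifies to \<open>Pc P\<^sub>\<sharp>\<^sup>T Mt\<close>, hence \<open>Pbar Rbar = P\<^sub>\<sharp> P\<^sub>\<sharp>\<^sup>T Mt\<close>: the scaling by
  \<open>Pc\<close>, which gives \<open>Pbar\<close> its identity block, disappears from the product. The ideal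
  interpolation is \<open>(I - S\<^sub>\<sharp> S\<^sub>\<sharp>\<^sup>T Mt) Z = Pbar (Rbar Z) = Pbar\<close>, whatever \<open>Z\<close> is.

  It remains to see that \<open>Pbar\<close> minimizes \<open>mu\<close>. Counting eigenpairs from zero, every
  matrix \<open>Q Rbar\<close> annihilates \<open>v nc\<close>, and this single test vector forces
  \<open>mu \<ge> 1 / lam nc\<close> (lemma \<open>mu_ge_if_kernel\<close>). For \<open>Pbar Rbar\<close> the
  coordinates \<open>c\<^sub>i = v\<^sub>i\<^sup>T Mt x\<close> make the numerator of the quotient the tail \<open>\<Sum>i\<ge>nc. c\<^sub>i\<^sup>2\<close>
  and the denominator \<open>\<Sum>i. lam i * c\<^sub>i\<^sup>2\<close>, so the bound \<open>1 / lam nc\<close> is attained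
  (lemma \<open>mu_eigs_le\<close>).
\<close>

section \<open>Inverses, associativity and transposition\<close>

text \<open>The following rules replace membership in \<^const>\<open>carrier_mat\<close>, whose parameters the
  simplifier would have to guess, by equations between dimensions, which it can decide by
  rewriting.\<close>

lemma mult_mat_assoc_dim:
  fixes X Y Z :: "real mat"
  assumes "dim_col X = dim_row Y" "dim_col Y = dim_row Z"
  shows "X * Y * Z = X * (Y * Z)"
  using assms by (intro assoc_mult_mat) auto

lemma transpose_mult_dim:
  fixes X Y :: "real mat"
  assumes "dim_col X = dim_row Y"
  shows "(X * Y)\<^sup>T = Y\<^sup>T * X\<^sup>T"
  using assms by (intro transpose_mult) auto

lemma mult_mat_vec_assoc_dim:
  fixes X Y :: "real mat"
  assumes "dim_col X = dim_row Y" "dim_col Y = dim_vec x"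
  shows "X * Y *\<^sub>v x = X *\<^sub>v (Y *\<^sub>v x)"
  using assms by (intro assoc_mult_mat_vec) auto

lemmas mat_product_simps = mult_mat_assoc_dim transpose_mult_dim left_mult_one_mat' right_mult_one_mat'

lemma minv_eqI:
  assumes X: "X \<in> carrier_mat k k" and Y: "Y \<in> carrier_mat k k" and XY: "X * Y = 1\<^sub>m k"
  shows "minv X = Y"
proof -
  have YX: "Y * X = 1\<^sub>m k"
    using mat_mult_left_right_inverse[OF X Y XY] .
  have "X \<in> Units (ring_mat TYPE(real) k undefined)"
    using X Y XY YX by (auto simp: Units_def ring_mat_simps)
  then obtain W where W: "mat_inverse X = Some W"
    using mat_inverse(1)[OF X, of undefined] by (cases "mat_inverse X") auto
  have "X * W = 1\<^sub>m k" "W \<in> carrier_mat k k"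
    using mat_inverse(2)[OF X W] by auto
  then have "W = (Y * X) * W"
    by (simp add: YX)
  also have "\<dots> = Y"
    using X Y \<open>X * W = 1\<^sub>m k\<close> \<open>W \<in> carrier_mat k k\<close>
    by (simp add: assoc_mult_mat[OF Y X])
  finally show ?thesis
    by (simp add: minv_def W)
qed

lemma invertible_minv:
  assumes X: "X \<in> carrier_mat k k" and inv: "invertible_mat X"
  shows "minv X \<in> carrier_mat k k" "X * minv X = 1\<^sub>m k" "minv X * X = 1\<^sub>m k"
proof -
  obtain Y where XY: "X * Y = 1\<^sub>m k" and YX: "Y * X = 1\<^sub>m (dim_row Y)"
    using inv X unfolding invertible_mat_def inverts_mat_def by auto
  have "dim_col Y = k"
    using arg_cong[OF XY, of dim_col] by simp
  moreover have "dim_row Y = k"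
    using arg_cong[OF YX, of dim_col] X by simp
  ultimately have Y: "Y \<in> carrier_mat k k"
    by auto
  have "minv X = Y"
    by (rule minv_eqI[OF X Y XY])
  with Y XY YX show "minv X \<in> carrier_mat k k" "X * minv X = 1\<^sub>m k" "minv X * X = 1\<^sub>m k"
    by auto
qed

lemma minv_one: "minv (1\<^sub>m k) = 1\<^sub>m k"
  by (rule minv_eqI) auto

lemma mat_diag_mult_reciprocal:
  fixes f :: "nat \<Rightarrow> real"
  assumes "\<And>i. i < k \<Longrightarrow> f i \<noteq> 0"
  shows "mat_diag k f * mat_diag k (\<lambda>i. 1 / f i) = 1\<^sub>m k"
  using assms unfolding mat_diag_diag by (intro eq_matI) (auto simp: mat_diag_def)

lemma spectrum_mat_diag: "spectrum (mat_diag k (f :: nat \<Rightarrow> real)) = f ` {..<k}"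
proof -
  let ?D = "mat_diag k f"
  have "upper_triangular ?D"
    by (auto simp: mat_diag_def)
  then have "char_poly ?D = (\<Prod>a\<leftarrow>diag_mat ?D. [:- a, 1:])"
    by (intro char_poly_upper_triangular[of _ k]) auto
  moreover have "diag_mat ?D = map f [0..<k]"
    by (auto simp: diag_mat_def mat_diag_def)
  ultimately have "poly (char_poly ?D) x = 0 \<longleftrightarrow> x \<in> f ` {..<k}" for x
    by (auto simp: poly_prod_list prod_list_zero_iff)
  then show ?thesis
    by (auto simp: spectrum_def eigenvalue_root_char_poly[of _ k])
qed

section \<open>Row blocks\<close>

lemma downward_closed_eq_lessThan:
  fixes F :: "nat set"
  assumes fin: "finite F" and down: "\<And>x y. y \<in> F \<Longrightarrow> x < y \<Longrightarrow> x \<in> F"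
  shows "F = {..<card F}"
proof (rule card_subset_eq)
  show "F \<subseteq> {..<card F}"
  proof
    fix y assume "y \<in> F"
    then have "{..y} \<subseteq> F"
      using down by (auto simp: order_le_less)
    from card_mono[OF fin this] show "y \<in> {..<card F}"
      by simp
  qed
qed auto

text \<open>The ordering of the unknowns, with \<open>F\<close> before \<open>C\<close>, makes \<open>F\<close> downward closed.
  This is what turns both parts of the partition into contiguous blocks of row indices.\<close>

lemma ordered_partition_blocks:
  fixes F C :: "nat set"
  assumes union: "F \<union> C = {0..<n}" and disj: "F \<inter> C = {}" and card: "card C = k"
    and first: "\<forall>i\<in>F. \<forall>j\<in>C. i < j"
  shows "F = {0..<n - k}" "C = {n - k..<n}"
proof -
  have fin: "finite F" "finite C"
    using union by (metis finite_Un finite_atLeastLessThan)+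
  have "card F + card C = n"
    using card_Un_disjoint[OF fin disj] union by simp
  then have card_F: "card F = n - k"
    using card by simp
  have "F = {..<card F}"
  proof (rule downward_closed_eq_lessThan[OF fin(1)])
    fix x y assume "y \<in> F" "x < y"
    have "y < n"
      using \<open>y \<in> F\<close> union by (metis UnI1 atLeastLessThan_iff)
    then have "x \<in> F \<union> C"
      using \<open>x < y\<close> union by simp
    then show "x \<in> F"
      using first \<open>y \<in> F\<close> \<open>x < y\<close> by (meson Un_iff less_asym)
  qed
  then show F: "F = {0..<n - k}"
    by (simp add: card_F lessThan_atLeast0)
  have "C = {0..<n} - F"
    using union disj by blast
  then show "C = {n - k..<n}"
    by (auto simp: F)
qed

lemma submatrix_row_block:
  assumes "b \<le> dim_row P"
  shows "submatrix P {a..<b} UNIV = mat (b - a) (dim_col P) (\<lambda>(i, j). P $$ (a + i, j))"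
proof -
  have "{i. i < dim_row P \<and> i \<in> {a..<b}} = {a..<b}"
    using assms by auto
  then have dims: "card {i. i < dim_row P \<and> i \<in> {a..<b}} = b - a"
    by (simp only: card_atLeastLessThan)
  have pick: "pick {a..<b} i = a + i" if "i < b - a" for i
  proof -
    have "{x \<in> {a..<b}. x < a + i} = {a..<a + i}"
      using that by auto
    then show ?thesis
      using pick_card_in_set[of "a + i" "{a..<b}"] that by simp
  qed
  show ?thesis
    unfolding submatrix_def dims by (intro eq_matI) (auto simp: pick pick_UNIV)
qed

lemma append_row_blocks:
  assumes "P \<in> carrier_mat n k" "m \<le> n"
  shows "P = submatrix P {0..<m} UNIV @\<^sub>r submatrix P {m..<n} UNIV"
  using assms by (intro eq_matI) (auto simp: submatrix_row_block append_rows_def)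

lemma append_rows_mult:
  fixes X Y W :: "real mat"
  assumes "X \<in> carrier_mat a k" "Y \<in> carrier_mat b k" "W \<in> carrier_mat k l"
  shows "(X @\<^sub>r Y) * W = (X * W) @\<^sub>r (Y * W)"
  using assms by (intro eq_matI) (auto simp: append_rows_def scalar_prod_def)

section \<open>Orthogonal projections and the measure \<open>mu\<close>\<close>

text \<open>A projection depends only on the range, so the change of basis \<open>W\<close> must drop out: the
  Gram matrix of \<open>P W\<close> is \<open>W\<^sup>T W\<close>, and \<open>W (W\<^sup>T W)\<^sup>-\<^sup>1 W\<^sup>T = I\<close>.\<close>

lemma orth_proj_change_basis:
  assumes P: "P \<in> carrier_mat n k" and X: "X \<in> carrier_mat n n"
    and G: "P\<^sup>T * X * P = 1\<^sub>m k"
    and W: "W \<in> carrier_mat k k" "invertible_mat W"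
  shows "orth_proj X (P * W) = P * P\<^sup>T * X"
proof -
  let ?I = "minv W"
  note I = invertible_minv[OF W]
  have d: "dim_row P = n" "dim_col P = k" "dim_row X = n" "dim_col X = n"
    "dim_row W = k" "dim_col W = k" "dim_row ?I = k" "dim_col ?I = k"
    using P X W I by auto
  have G': "P\<^sup>T * (X * P) = 1\<^sub>m k"
    using G by (simp add: mat_product_simps d)
  have gram: "(P * W)\<^sup>T * X * (P * W) = W\<^sup>T * W"
  proof -
    have "(P * W)\<^sup>T * X * (P * W) = W\<^sup>T * ((P\<^sup>T * (X * P)) * W)"
      by (simp add: mat_product_simps d)
    then show ?thesis
      by (simp add: G' mat_product_simps d)
  qed
  have IT: "W\<^sup>T * ?I\<^sup>T = 1\<^sub>m k" "?I\<^sup>T * W\<^sup>T = 1\<^sub>m k"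
    using I(2,3) by (simp_all add: transpose_mult_dim[symmetric] d)
  have "minv (W\<^sup>T * W) = ?I * ?I\<^sup>T"
  proof (rule minv_eqI[of _ k])
    have "W\<^sup>T * W * (?I * ?I\<^sup>T) = W\<^sup>T * ((W * ?I) * ?I\<^sup>T)"
      by (simp add: mat_product_simps d)
    then show "W\<^sup>T * W * (?I * ?I\<^sup>T) = 1\<^sub>m k"
      by (simp add: I IT mat_product_simps d)
  qed (use W I in auto)
  then have "orth_proj X (P * W) = P * ((W * ?I) * ((?I\<^sup>T * W\<^sup>T) * (P\<^sup>T * X)))"
    unfolding orth_proj_def gram by (simp add: mat_product_simps d)
  then show ?thesis
    by (simp add: I IT mat_product_simps d)
qed

text \<open>On the kernel of \<open>Q\<close> the error propagator \<open>I - Q\<close> acts as the identity, so such a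
  vector contributes its plain Rayleigh quotient to the supremum.\<close>

lemma mu_ge_on_kernel:
  assumes "A \<in> carrier_mat n n" "Q \<in> carrier_mat n n" "x \<in> carrier_vec n" "x \<noteq> 0\<^sub>v n"
    and "Q *\<^sub>v x = 0\<^sub>v n"
  shows "ereal (sq_norm_mat X x / sq_norm_mat A x) \<le> mu A X Q"
proof -
  have "(1\<^sub>m n - Q) *\<^sub>v x = x"
    using assms by (simp add: minus_mult_distrib_mat_vec[of _ n n])
  then show ?thesis
    using assms unfolding mu_def Let_def by (intro SUP_upper2[of x]) auto
qed

section \<open>Eigenbases of a generalized symmetric eigenproblem\<close>

text \<open>For the matrix \<open>V\<close> with columns \<open>v i\<close>, a full \<open>B\<close>-orthonormal family forces
  \<open>B = (V V\<^sup>T)\<^sup>-\<^sup>1\<close>; the symmetry of \<open>B\<close> is therefore a consequence (lemma \<open>B_sym\<close>).\<close>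

locale generalized_eigenbasis =
  fixes n :: nat and A B :: "real mat" and lam :: "nat \<Rightarrow> real" and v :: "nat \<Rightarrow> real vec"
  assumes A: "spd_mat n A" and B: "B \<in> carrier_mat n n"
    and v_carrier: "i < n \<Longrightarrow> v i \<in> carrier_vec n"
    and v_eigen: "i < n \<Longrightarrow> A *\<^sub>v v i = lam i \<cdot>\<^sub>v (B *\<^sub>v v i)"
    and v_orthonormal: "i < n \<Longrightarrow> j < n \<Longrightarrow> v i \<bullet> (B *\<^sub>v v j) = (if i = j then 1 else 0)"
begin

definition eigs :: "nat \<Rightarrow> nat \<Rightarrow> real mat" where
  "eigs k m = mat_of_cols n (map v [k..<m])"

lemma A_carrier: "A \<in> carrier_mat n n" and A_sym: "A\<^sup>T = A"
  using A by (auto simp: spd_mat_def)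

lemma dims [simp]:
  "dim_row A = n" "dim_col A = n" "dim_row B = n" "dim_col B = n"
  "dim_row (eigs k m) = n" "dim_col (eigs k m) = m - k"
  using A_carrier B by (auto simp: eigs_def)

lemma eigs_carrier [simp]: "eigs k m \<in> carrier_mat n (m - k)"
  by (rule carrier_matI) simp_all

lemma col_eigs: "m \<le> n \<Longrightarrow> j < m - k \<Longrightarrow> col (eigs k m) j = v (k + j)"
  by (simp add: eigs_def v_carrier)

lemma eigs_index: "m \<le> n \<Longrightarrow> i < n \<Longrightarrow> j < m - k \<Longrightarrow> eigs k m $$ (i, j) = v (k + j) $ i"
  by (simp add: eigs_def mat_of_cols_index)

lemma gram_index:
  assumes "m \<le> n" "m' \<le> n" "i < m - k" "j < m' - k'"
  shows "((eigs k m)\<^sup>T * (B * eigs k' m')) $$ (i, j) = (if k + i = k' + j then 1 else 0)"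
proof -
  have "((eigs k m)\<^sup>T * (B * eigs k' m')) $$ (i, j) = v (k + i) \<bullet> (B *\<^sub>v v (k' + j))"
    using assms by (simp add: col_eigs col_mult2[OF B eigs_carrier])
  then show ?thesis
    using assms by (simp add: v_orthonormal)
qed

lemma gram_eigs: "m \<le> n \<Longrightarrow> (eigs k m)\<^sup>T * (B * eigs k m) = 1\<^sub>m (m - k)"
  by (intro eq_matI) (auto simp: gram_index simp del: index_mult_mat(1))

lemma gram_eigs_disjoint:
  "m \<le> k' \<Longrightarrow> m' \<le> n \<Longrightarrow> m \<le> n \<Longrightarrow> (eigs k m)\<^sup>T * (B * eigs k' m') = 0\<^sub>m (m - k) (m' - k')"
  by (intro eq_matI) (auto simp: gram_index simp del: index_mult_mat(1))

lemma A_eigs: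
  assumes "m \<le> n"
  shows "A * eigs k m = B * (eigs k m * mat_diag (m - k) (\<lambda>j. lam (k + j)))" (is "_ = B * (_ * ?D)")
proof -
  have "A * eigs k m = (B * eigs k m) * ?D"
  proof (rule eq_matI)
    fix i j
    assume "i < dim_row ((B * eigs k m) * ?D)" "j < dim_col ((B * eigs k m) * ?D)"
    then have ij: "i < n" "j < m - k"
      by (auto simp: mat_diag_def)
    have "(A * eigs k m) $$ (i, j) = (A *\<^sub>v v (k + j)) $ i"
      using ij assms by (simp add: col_eigs)
    also have "\<dots> = (B * eigs k m) $$ (i, j) * lam (k + j)"
      using ij assms by (simp add: v_eigen col_eigs)
    also have "\<dots> = ((B * eigs k m) * ?D) $$ (i, j)"
      using ij B by (subst mat_diag_mult_right[of _ n]) auto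
    finally show "(A * eigs k m) $$ (i, j) = ((B * eigs k m) * ?D) $$ (i, j)" .
  qed (auto simp: mat_diag_def)
  then show ?thesis
    by (simp add: mult_mat_assoc_dim mat_diag_def)
qed

lemma A_gram_eigs:
  assumes "m \<le> n"
  shows "(eigs k m)\<^sup>T * (A * eigs k m) = mat_diag (m - k) (\<lambda>j. lam (k + j))" (is "_ = ?D")
proof -
  have "(eigs k m)\<^sup>T * (A * eigs k m) = ((eigs k m)\<^sup>T * (B * eigs k m)) * ?D"
    by (simp add: A_eigs[OF assms] mult_mat_assoc_dim mat_diag_def)
  then show ?thesis
    by (simp add: gram_eigs[OF assms] left_mult_one_mat[OF mat_diag_dim])
qed

lemma lam_eq_energy: "i < n \<Longrightarrow> v i \<bullet> (A *\<^sub>v v i) = lam i"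
  using v_carrier[of i] scalar_prod_smult_right[of "v i" "B *\<^sub>v v i" "lam i"]
  by (simp add: v_eigen v_orthonormal)

lemma v_nonzero: "i < n \<Longrightarrow> v i \<noteq> 0\<^sub>v n"
  using v_orthonormal[of i i] scalar_prod_left_zero[of "B *\<^sub>v v i" n] mult_mat_vec_carrier[OF B v_carrier]
  by fastforce

lemma lam_pos: "i < n \<Longrightarrow> 0 < lam i"
  using A v_carrier[of i] v_nonzero[of i] lam_eq_energy[of i] unfolding spd_mat_def by metis

text \<open>Orthonormality exhibits \<open>V\<^sup>T B\<close> as a left inverse of the square matrix \<open>V\<close>; a left
  inverse of a square matrix is also a right inverse.\<close>

lemma completeness: "eigs 0 n * ((eigs 0 n)\<^sup>T * B) = 1\<^sub>m n"
proof (rule mat_mult_left_right_inverse)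
  show "((eigs 0 n)\<^sup>T * B) * eigs 0 n = 1\<^sub>m n"
    using gram_eigs[of n 0] by (simp add: mult_mat_assoc_dim)
qed (auto intro!: carrier_matI)

text \<open>Transposing completeness shows that \<open>B\<^sup>T\<close> is a left inverse of \<open>V V\<^sup>T\<close>, while
  completeness itself makes \<open>B\<close> a right inverse.\<close>

lemma B_sym: "B\<^sup>T = B"
proof -
  let ?V = "eigs 0 n"
  have "B\<^sup>T * (?V * ?V\<^sup>T) = (?V * (?V\<^sup>T * B))\<^sup>T"
    by (simp add: mat_product_simps)
  then have T: "B\<^sup>T * (?V * ?V\<^sup>T) = 1\<^sub>m n"
    by (simp add: completeness)
  have "B\<^sup>T = B\<^sup>T * (?V * (?V\<^sup>T * B))"
    by (simp add: completeness right_mult_one_mat')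
  also have "\<dots> = (B\<^sup>T * (?V * ?V\<^sup>T)) * B"
    by (simp add: mat_product_simps)
  also have "\<dots> = B"
    by (simp add: T left_mult_one_mat')
  finally show ?thesis .
qed

text \<open>Completeness with the rank-one contributions of the eigenvectors grouped at \<open>k\<close>. The two
  summands are the \<open>B\<close>-orthogonal projections onto the complementary eigenspans.\<close>

lemma splitting:
  assumes "k \<le> n"
  shows "eigs 0 k * ((eigs 0 k)\<^sup>T * B) + eigs k n * ((eigs k n)\<^sup>T * B) = 1\<^sub>m n"
proof -
  have "eigs 0 n * (eigs 0 n)\<^sup>T = eigs 0 k * (eigs 0 k)\<^sup>T + eigs k n * (eigs k n)\<^sup>T"
    (is "?V * _ = ?P * _ + ?S * _")
  proof (rule eq_matI)
    fix i j
    assume "i < dim_row (?P * ?P\<^sup>T + ?S * ?S\<^sup>T)" "j < dim_col (?P * ?P\<^sup>T + ?S * ?S\<^sup>T)"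
    then have ij: "i < n" "j < n"
      by auto
    let ?f = "\<lambda>l. v l $ i * v l $ j"
    have entry: "(eigs a b * (eigs a b)\<^sup>T) $$ (i, j) = (\<Sum>l = a..<b. ?f l)" if "b \<le> n" for a b
      using that ij sum.shift_bounds_nat_ivl[of ?f 0 a "b - a"]
      by (cases "a \<le> b") (auto simp: scalar_prod_def eigs_index add.commute)
    have "(?V * ?V\<^sup>T) $$ (i, j) = (\<Sum>l = 0..<k. ?f l) + (\<Sum>l = k..<n. ?f l)"
      using assms by (simp add: entry sum.atLeastLessThan_concat del: index_mult_mat(1))
    also have "\<dots> = (?P * ?P\<^sup>T + ?S * ?S\<^sup>T) $$ (i, j)"
      using ij assms by (simp add: entry[symmetric] del: index_mult_mat(1))
    finally show "(?V * ?V\<^sup>T) $$ (i, j) = (?P * ?P\<^sup>T + ?S * ?S\<^sup>T) $$ (i, j)" .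
  qed auto
  then have "(?V * ?V\<^sup>T) * B = (?P * ?P\<^sup>T + ?S * ?S\<^sup>T) * B"
    by simp
  moreover have "(?P * ?P\<^sup>T + ?S * ?S\<^sup>T) * B = ?P * ?P\<^sup>T * B + ?S * ?S\<^sup>T * B"
    by (rule add_mult_distrib_mat[of _ n n _ _ n]) (auto intro!: carrier_matI)
  ultimately show ?thesis
    using completeness by (simp add: mult_mat_assoc_dim)
qed

lemma orth_proj_B_eigs: "m \<le> n \<Longrightarrow> orth_proj B (eigs k m) = eigs k m * ((eigs k m)\<^sup>T * B)"
  by (simp add: orth_proj_def gram_eigs minv_one mat_product_simps)

text \<open>On a span \<open>E\<close> of eigenvectors the \<open>A\<close>-orthogonal and the \<open>B\<close>-orthogonal projection
  agree: \<open>E\<^sup>T A E = D\<close> and \<open>E\<^sup>T A = D E\<^sup>T B\<close> for the diagonal matrix \<open>D\<close> of eigenvalues.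
  The left-hand side is left unfolded because it occurs both in \<^const>\<open>orth_proj\<close> and in
  \<^const>\<open>ideal_interp\<close>.\<close>

lemma A_proj_eigs:
  assumes "m \<le> n"
  shows "eigs k m * minv ((eigs k m)\<^sup>T * A * eigs k m) * (eigs k m)\<^sup>T * A
    = eigs k m * ((eigs k m)\<^sup>T * B)"
proof -
  let ?E = "eigs k m" and ?D = "mat_diag (m - k) (\<lambda>j. lam (k + j))"
  let ?I = "mat_diag (m - k) (\<lambda>j. 1 / lam (k + j))"
  have gram: "?E\<^sup>T * A * ?E = ?D"
    using A_gram_eigs[OF assms] by (simp add: mult_mat_assoc_dim)
  have nz: "lam (k + j) \<noteq> 0" if "j < m - k" for j
  proof -
    have "k + j < n"
      using that assms by linarith
    from lam_pos[OF this] show ?thesis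
      by simp
  qed
  have DI: "?D * ?I = 1\<^sub>m (m - k)"
    using nz by (rule mat_diag_mult_reciprocal)
  have inv: "minv ?D = ?I"
    by (rule minv_eqI[OF _ _ DI]) auto
  have ID: "?I * ?D = 1\<^sub>m (m - k)"
    by (rule mat_mult_left_right_inverse[OF _ _ DI]) auto
  have D_sym: "?D\<^sup>T = ?D"
    by (auto simp: mat_diag_def intro!: eq_matI)
  have [simp]: "dim_row ?D = m - k" "dim_col ?D = m - k" "dim_row ?I = m - k" "dim_col ?I = m - k"
    by (auto simp: mat_diag_def)
  have "?E\<^sup>T * A = (A * ?E)\<^sup>T"
    by (simp add: mat_product_simps A_sym)
  also have "\<dots> = ?D * (?E\<^sup>T * B)"
    unfolding A_eigs[OF assms] by (simp add: mat_product_simps D_sym B_sym)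
  finally have EA: "?E\<^sup>T * A = ?D * (?E\<^sup>T * B)" .
  have "?E * ?I * ?E\<^sup>T * A = ?E * (?I * (?E\<^sup>T * A))"
    by (simp add: mat_product_simps)
  also have "\<dots> = ?E * ((?I * ?D) * (?E\<^sup>T * B))"
    unfolding EA by (simp add: mult_mat_assoc_dim del: mat_diag_diag)
  also have "\<dots> = ?E * (?E\<^sup>T * B)"
    unfolding ID by (simp add: mat_product_simps)
  finally show ?thesis
    by (simp only: gram inv)
qed

text \<open>The two Gram matrices are the identity and the diagonal matrix of the eigenvalues from
  index \<open>k\<close> on, whose spectrum is read off the diagonal.\<close>

lemma lambda_min_eigs:
  assumes "k < n" and sorted: "\<forall>i j. i \<le> j \<and> j < n \<longrightarrow> lam i \<le> lam j"
  shows "lambda_min (minv ((eigs k n)\<^sup>T * B * eigs k n) * ((eigs k n)\<^sup>T * A * eigs k n)) = lam k"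
proof -
  have "minv ((eigs k n)\<^sup>T * B * eigs k n) * ((eigs k n)\<^sup>T * A * eigs k n)
      = mat_diag (n - k) (\<lambda>j. lam (k + j))"
    by (simp add: mult_mat_assoc_dim gram_eigs A_gram_eigs minv_one left_mult_one_mat[OF mat_diag_dim])
  moreover have "Min ((\<lambda>j. lam (k + j)) ` {..<n - k}) = lam k"
    using assms by (intro Min_eqI) (auto intro: image_eqI[of _ _ 0])
  ultimately show ?thesis
    by (simp add: lambda_min_def spectrum_mat_diag)
qed

text \<open>By completeness, \<open>w = V\<^sup>T B x\<close> is the coordinate vector of \<open>x\<close> in the eigenbasis, and
  \<open>V\<^sup>T A V\<close> is diagonal.\<close>

lemma energy_expansion:
  assumes x: "x \<in> carrier_vec n"
  shows "sq_norm_mat A x = (\<Sum>i<n. lam i * (v i \<bullet> (B *\<^sub>v x))\<^sup>2)"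
proof -
  let ?V = "eigs 0 n"
  define w where "w = ?V\<^sup>T *\<^sub>v (B *\<^sub>v x)"
  have V: "?V \<in> carrier_mat n n"
    using eigs_carrier[of 0 n] by simp
  have Bx: "B *\<^sub>v x \<in> carrier_vec n"
    using B x by simp
  have w: "w \<in> carrier_vec n"
    using V Bx by (simp add: w_def)
  have w_index: "w $ i = v i \<bullet> (B *\<^sub>v x)" if "i < n" for i
    using that by (simp add: w_def col_eigs)
  have "x = (?V * (?V\<^sup>T * B)) *\<^sub>v x"
    using x by (simp add: completeness)
  also have "\<dots> = ?V *\<^sub>v w"
    using V B x by (simp add: w_def assoc_mult_mat_vec[of _ n n _ n])
  finally have x_eq: "x = ?V *\<^sub>v w" .
  let ?D = "mat_diag n lam"
  have "x \<bullet> (A *\<^sub>v x) = (?V *\<^sub>v w) \<bullet> (A *\<^sub>v (?V *\<^sub>v w))"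
    using x_eq by simp
  also have "\<dots> = w \<bullet> (?V\<^sup>T *\<^sub>v (A *\<^sub>v (?V *\<^sub>v w)))"
    using transpose_vec_mult_scalar[of "?V\<^sup>T" n n "A *\<^sub>v (?V *\<^sub>v w)" w] V A_carrier w by simp
  also have "?V\<^sup>T *\<^sub>v (A *\<^sub>v (?V *\<^sub>v w)) = (?V\<^sup>T * (A * ?V)) *\<^sub>v w"
    using V A_carrier w by (simp add: assoc_mult_mat_vec[of _ n n _ n])
  also have "?V\<^sup>T * (A * ?V) = ?D"
    using A_gram_eigs[of n 0] by simp
  also have "w \<bullet> (?D *\<^sub>v w) = (\<Sum>i<n. lam i * (w $ i)\<^sup>2)"
  proof -
    have "(?D *\<^sub>v w) $ i = lam i * w $ i" if "i < n" for i
      using that w by (simp add: mat_diag_def scalar_prod_def if_distrib[of "\<lambda>c. c * _"] cong: if_cong)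
    then show ?thesis
      using w by (auto simp: scalar_prod_def lessThan_atLeast0 mat_diag_def power2_eq_square
          intro!: sum.cong)
  qed
  finally show ?thesis
    by (simp add: sq_norm_mat_def w_index)
qed

text \<open>Subtracting the projection onto the first \<open>k\<close> eigenvectors leaves, by the splitting,
  the combination \<open>S c\<close> of the others; as \<open>S\<^sup>T B S = I\<close>, its squared norm is that of \<open>c\<close>.\<close>

lemma tail_norm_expansion:
  assumes x: "x \<in> carrier_vec n" and k: "k \<le> n"
  shows "sq_norm_mat B ((1\<^sub>m n - eigs 0 k * ((eigs 0 k)\<^sup>T * B)) *\<^sub>v x)
    = (\<Sum>i = k..<n. (v i \<bullet> (B *\<^sub>v x))\<^sup>2)"
proof -
  let ?S = "eigs k n" and ?P = "eigs 0 k"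
  define c where "c = ?S\<^sup>T *\<^sub>v (B *\<^sub>v x)"
  have c: "c \<in> carrier_vec (n - k)"
    by (auto simp: c_def intro!: carrier_vecI)
  have c_index: "c $ j = v (k + j) \<bullet> (B *\<^sub>v x)" if "j < n - k" for j
    using that by (simp add: c_def col_eigs)
  have Sc: "?S *\<^sub>v c \<in> carrier_vec n"
    using c by (auto intro!: carrier_vecI)
  have "1\<^sub>m n - ?P * (?P\<^sup>T * B) = ?S * (?S\<^sup>T * B)"
    unfolding splitting[OF k, symmetric] by (intro eq_matI) auto
  then have "(1\<^sub>m n - ?P * (?P\<^sup>T * B)) *\<^sub>v x = ?S *\<^sub>v c"
    using carrier_vecD[OF x] by (simp add: c_def mult_mat_vec_assoc_dim)
  moreover have "(?S *\<^sub>v c) \<bullet> (B *\<^sub>v (?S *\<^sub>v c)) = c \<bullet> (?S\<^sup>T *\<^sub>v (B *\<^sub>v (?S *\<^sub>v c)))"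
    using transpose_vec_mult_scalar[of "?S\<^sup>T" "n - k" n "B *\<^sub>v (?S *\<^sub>v c)" c] B Sc c by simp
  moreover have "?S\<^sup>T *\<^sub>v (B *\<^sub>v (?S *\<^sub>v c)) = (?S\<^sup>T * (B * ?S)) *\<^sub>v c"
    using carrier_vecD[OF c] by (simp add: mult_mat_vec_assoc_dim)
  moreover have "(?S\<^sup>T * (B * ?S)) *\<^sub>v c = c"
    using c by (simp add: gram_eigs)
  ultimately have "sq_norm_mat B ((1\<^sub>m n - ?P * (?P\<^sup>T * B)) *\<^sub>v x) = c \<bullet> c"
    by (simp add: sq_norm_mat_def)
  also have "\<dots> = (\<Sum>j = 0..<n - k. (v (k + j) \<bullet> (B *\<^sub>v x))\<^sup>2)"
    using carrier_vecD[OF c] by (simp add: scalar_prod_def[of c c] c_index power2_eq_square)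
  also have "\<dots> = (\<Sum>i = k..<n. (v i \<bullet> (B *\<^sub>v x))\<^sup>2)"
    using sum.shift_bounds_nat_ivl[of "\<lambda>i. (v i \<bullet> (B *\<^sub>v x))\<^sup>2" 0 k "n - k"] k
    by (simp add: add.commute)
  finally show ?thesis .
qed

text \<open>Each eigenvalue in the tail is at least \<open>lam k\<close>, and the head of the energy expansion
  is nonnegative, so \<open>lam k\<close> times the tail norm is dominated by the energy.\<close>

lemma mu_eigs_le:
  assumes k: "k < n" and sorted: "\<forall>i j. i \<le> j \<and> j < n \<longrightarrow> lam i \<le> lam j"
  shows "mu A B (eigs 0 k * ((eigs 0 k)\<^sup>T * B)) \<le> ereal (1 / lam k)"
  unfolding mu_def Let_def dims(1)
proof (rule SUP_least)
  fix x :: "real vec" assume "x \<in> carrier_vec n - {0\<^sub>v n}"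
  then have x: "x \<in> carrier_vec n" "x \<noteq> 0\<^sub>v n"
    by auto
  let ?c = "\<lambda>i. (v i \<bullet> (B *\<^sub>v x))\<^sup>2"
  have pos: "0 < sq_norm_mat A x"
    using A x by (simp add: sq_norm_mat_def spd_mat_def)
  have "lam k * (\<Sum>i = k..<n. ?c i) = (\<Sum>i = k..<n. lam k * ?c i)"
    by (rule sum_distrib_left)
  also have "\<dots> \<le> (\<Sum>i = k..<n. lam i * ?c i)"
    using sorted by (intro sum_mono mult_right_mono) auto
  also have "\<dots> \<le> (\<Sum>i<n. lam i * ?c i)"
    using lam_pos by (intro sum_mono2) (auto simp: less_imp_le)
  finally have "lam k * sq_norm_mat B ((1\<^sub>m n - eigs 0 k * ((eigs 0 k)\<^sup>T * B)) *\<^sub>v x)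
      \<le> sq_norm_mat A x"
    using k x by (simp add: energy_expansion tail_norm_expansion)
  then show "ereal (sq_norm_mat B ((1\<^sub>m n - eigs 0 k * ((eigs 0 k)\<^sup>T * B)) *\<^sub>v x) / sq_norm_mat A x)
      \<le> ereal (1 / lam k)"
    using pos lam_pos[OF k] by (simp add: field_simps)
qed

lemma mu_ge_if_kernel:
  assumes k: "k < n" and Q: "Q \<in> carrier_mat n n" and ker: "Q *\<^sub>v v k = 0\<^sub>v n"
  shows "ereal (1 / lam k) \<le> mu A B Q"
  using mu_ge_on_kernel[OF A_carrier Q v_carrier[OF k] v_nonzero[OF k] ker, of B] k
  by (simp add: sq_norm_mat_def lam_eq_energy v_orthonormal)

end

section \<open>Optimality of the ideal interpolation\<close>

theorem lemma3:
  fixes n nc :: nat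
    and F C :: "nat set"
    and A M Mt Psharp Pf Pc Pbar Rbar Ssharp :: "real mat"
    and lam :: "nat \<Rightarrow> real"
    and v :: "nat \<Rightarrow> real vec"
  assumes nc: "1 \<le> nc" "nc < n"
    and FC: "F \<union> C = {0..<n}" "F \<inter> C = {}" "card C = nc"
    and F_first: "\<forall>i\<in>F. \<forall>j\<in>C. i < j"
    and A: "spd_mat n A"
    and M: "M \<in> carrier_mat n n" "spd_mat n (M + M\<^sup>T - A)"
    and Mt: "Mt = sym_smoother A M"
    (* indices start at 0: lam i and v i are the (i+1)-st eigenvalue and eigenvector *)
    and lam_sorted: "\<forall>i j. i \<le> j \<and> j < n \<longrightarrow> lam i \<le> lam j"
    and v_carrier: "\<forall>i<n. v i \<in> carrier_vec n"
    and v_eigen: "\<forall>i<n. A *\<^sub>v v i = lam i \<cdot>\<^sub>v (Mt *\<^sub>v v i)"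
    and v_orthonormal: "\<forall>i<n. \<forall>j<n. v i \<bullet> (Mt *\<^sub>v v j) = (if i = j then 1 else 0)"
    and Psharp: "Psharp = mat_of_cols n (map v [0..<nc])"
    and Pf: "Pf = submatrix Psharp F UNIV"
    and Pc: "Pc = submatrix Psharp C UNIV"
    and Pc_nonsingular: "invertible_mat Pc"
    and Pbar: "Pbar = Psharp * minv Pc"
    and Rbar: "Rbar = (Pbar * Pc * Pc\<^sup>T)\<^sup>T * Mt"
    and Ssharp: "Ssharp = mat_of_cols n (map v [nc..<n])"
  shows "(Psharp = Pf @\<^sub>r Pc \<and> Pbar = (Pf * minv Pc) @\<^sub>r 1\<^sub>m nc) \<and>
    (Rbar * Pbar = 1\<^sub>m nc \<and> Rbar * Ssharp = 0\<^sub>m nc (n - nc) \<and>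
      Pbar * Rbar = orth_proj Mt Psharp \<and> orth_proj Mt Psharp = orth_proj A Psharp) \<and>
    1 / lambda_min (minv (Ssharp\<^sup>T * Mt * Ssharp) * (Ssharp\<^sup>T * A * Ssharp)) = 1 / lam nc \<and>
    (\<forall>Z \<in> carrier_mat n nc. Rbar * Z = 1\<^sub>m nc \<longrightarrow>
      is_arg_min (\<lambda>P. mu A Mt (P * Rbar)) (\<lambda>P. P \<in> carrier_mat n nc \<and> Rbar * P = 1\<^sub>m nc)
        (ideal_interp A Ssharp Z) \<and>
      ideal_interp A Ssharp Z = orth_proj Mt Pbar * Z \<and>
      orth_proj Mt Pbar * Z = Pbar * (Rbar * Z) \<and>
      Pbar * (Rbar * Z) = Pbar)"
proof -
  have Mt_carrier: "Mt \<in> carrier_mat n n"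
    using M(1) by (auto simp: Mt sym_smoother_def)
  interpret generalized_eigenbasis n A Mt lam v
    using A Mt_carrier v_carrier v_eigen v_orthonormal by unfold_locales auto
  let ?P = "eigs 0 nc" and ?S = "eigs nc n"
  have P: "Psharp = ?P" and S: "Ssharp = ?S"
    by (simp_all add: Psharp Ssharp eigs_def)
  have blocks: "F = {0..<n - nc}" "C = {n - nc..<n}"
    using ordered_partition_blocks[OF FC F_first] by auto
  have P_split: "Psharp = Pf @\<^sub>r Pc"
    unfolding Pf Pc blocks P by (rule append_row_blocks[of _ n nc]) (use eigs_carrier[of 0 nc] in auto)
  have Pc_carrier: "Pc \<in> carrier_mat nc nc" and Pf_carrier: "Pf \<in> carrier_mat (n - nc) nc"
    unfolding Pc Pf blocks P using nc by (simp_all add: submatrix_row_block)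
  let ?I = "minv Pc"
  note I = invertible_minv[OF Pc_carrier Pc_nonsingular]
  have d [simp]: "dim_row Pc = nc" "dim_col Pc = nc" "dim_row ?I = nc" "dim_col ?I = nc"
    using Pc_carrier I by auto
  have Pbar_split: "Pbar = (Pf * ?I) @\<^sub>r 1\<^sub>m nc"
    unfolding Pbar P_split append_rows_mult[OF Pf_carrier Pc_carrier I(1)] I(2) ..
  have Pbar_P: "Pbar = ?P * ?I"
    by (simp add: Pbar P)
  have "Pbar * Pc = ?P * (?I * Pc)"
    by (simp add: Pbar_P mat_product_simps)
  then have Rbar_P: "Rbar = Pc * (?P\<^sup>T * Mt)"
    by (simp add: Rbar I mat_product_simps)
  have Rbar_carrier: "Rbar \<in> carrier_mat nc n"
    by (auto simp: Rbar_P intro!: carrier_matI)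
  have Pbar_carrier: "Pbar \<in> carrier_mat n nc"
    by (auto simp: Pbar_P intro!: carrier_matI)
  have RP: "Rbar * Pbar = 1\<^sub>m nc"
  proof -
    have "Rbar * Pbar = Pc * ((?P\<^sup>T * (Mt * ?P)) * ?I)"
      by (simp add: Rbar_P Pbar_P mat_product_simps)
    then show ?thesis
      using nc by (simp add: gram_eigs I mat_product_simps)
  qed
  have RS: "Rbar * Ssharp = 0\<^sub>m nc (n - nc)"
  proof -
    have "Rbar * Ssharp = Pc * (?P\<^sup>T * (Mt * ?S))"
      by (simp add: Rbar_P S mat_product_simps)
    then show ?thesis
      using nc Pc_carrier by (simp add: gram_eigs_disjoint)
  qed
  have PR: "Pbar * Rbar = ?P * (?P\<^sup>T * Mt)"
  proof -
    have "Pbar * Rbar = ?P * ((?I * Pc) * (?P\<^sup>T * Mt))"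
      by (simp add: Rbar_P Pbar_P mat_product_simps)
    then show ?thesis
      by (simp add: I mat_product_simps)
  qed
  have proj_Mt: "orth_proj Mt Psharp = ?P * (?P\<^sup>T * Mt)"
    using nc by (simp add: P orth_proj_B_eigs)
  have proj_A: "orth_proj A Psharp = ?P * (?P\<^sup>T * Mt)"
    using nc by (simp add: P orth_proj_def A_proj_eigs)
  have proj_Pbar: "orth_proj Mt Pbar = Pbar * Rbar"
  proof -
    have "orth_proj Mt (?P * ?I) = ?P * ?P\<^sup>T * Mt"
    proof (rule orth_proj_change_basis[of _ n nc])
      show "?P\<^sup>T * Mt * ?P = 1\<^sub>m nc"
        using nc gram_eigs[of nc 0] by (simp add: mult_mat_assoc_dim)
      show "invertible_mat ?I"
        unfolding invertible_mat_def inverts_mat_def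
        by (intro conjI exI[of _ Pc]) (simp_all add: I)
      show "?P \<in> carrier_mat n nc"
        using eigs_carrier[of 0 nc] by simp
    qed (fact Mt_carrier I(1))+
    then show ?thesis
      unfolding PR by (simp add: Pbar_P mult_mat_assoc_dim)
  qed
  have lmin: "lambda_min (minv (Ssharp\<^sup>T * Mt * Ssharp) * (Ssharp\<^sup>T * A * Ssharp)) = lam nc"
    unfolding S by (rule lambda_min_eigs[OF nc(2) lam_sorted])
  \<comment> \<open>The upper bound attained by \<open>Pbar\<close> is the lower bound that \<open>v nc\<close> imposes on every \<open>Q\<close>.\<close>
  have optimal: "mu A Mt (Pbar * Rbar) \<le> mu A Mt (Q * Rbar)"
    if Q: "Q \<in> carrier_mat n nc" for Q
  proof -
    have "Rbar *\<^sub>v v nc = col (Rbar * Ssharp) 0"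
      using nc Rbar_carrier by (simp add: S col_mult2[of _ _ n _ "n - nc"] col_eigs)
    also have "\<dots> = 0\<^sub>v nc"
      using nc by (simp add: RS)
    finally have "(Q * Rbar) *\<^sub>v v nc = Q *\<^sub>v 0\<^sub>v nc"
      using Q Rbar_carrier v_carrier nc by (simp add: assoc_mult_mat_vec[of _ n nc _ n])
    also have "\<dots> = 0\<^sub>v n"
      using Q by (auto intro!: eq_vecI)
    finally have "ereal (1 / lam nc) \<le> mu A Mt (Q * Rbar)"
      using Q Rbar_carrier nc by (intro mu_ge_if_kernel) auto
    with mu_eigs_le[OF nc(2) lam_sorted] show ?thesis
      unfolding PR by (rule order_trans)
  qed
  have ideal: "ideal_interp A Ssharp Z = Pbar" if Z: "Z \<in> carrier_mat n nc" and RZ: "Rbar * Z = 1\<^sub>m nc" for Z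
  proof -
    have "1\<^sub>m n - ?S * (?S\<^sup>T * Mt) = Pbar * Rbar"
      unfolding splitting[OF less_imp_le[OF nc(2)], symmetric] PR by (intro eq_matI) auto
    then have "ideal_interp A Ssharp Z = (Pbar * Rbar) * Z"
      by (simp add: ideal_interp_def S A_proj_eigs)
    also have "\<dots> = Pbar"
      using Z Rbar_carrier Pbar_carrier by (simp add: assoc_mult_mat[of _ n nc _ n _ nc] RZ)
    finally show ?thesis .
  qed
  show ?thesis
  proof (intro conjI ballI impI)
    fix Z assume Z: "Z \<in> carrier_mat n nc" and RZ: "Rbar * Z = 1\<^sub>m nc"
    show "is_arg_min (\<lambda>P. mu A Mt (P * Rbar)) (\<lambda>P. P \<in> carrier_mat n nc \<and> Rbar * P = 1\<^sub>m nc)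
        (ideal_interp A Ssharp Z)"
      using optimal Pbar_carrier RP by (auto simp: is_arg_min_def ideal[OF Z RZ] not_less)
    have PRZ: "Pbar * Rbar * Z = Pbar * (Rbar * Z)"
      using Z Rbar_carrier Pbar_carrier by (simp add: assoc_mult_mat[of _ n nc _ n _ nc])
    show Pbar_RZ: "Pbar * (Rbar * Z) = Pbar"
      using Pbar_carrier by (simp add: RZ)
    show "orth_proj Mt Pbar * Z = Pbar * (Rbar * Z)"
      by (simp only: proj_Pbar PRZ)
    then show "ideal_interp A Ssharp Z = orth_proj Mt Pbar * Z"
      by (simp add: ideal[OF Z RZ] Pbar_RZ)
  qed (simp_all only: P_split[symmetric] Pbar_split[symmetric] RP RS PR proj_Mt proj_A lmin)
qed

end
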